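(* Let $P\subset\mathbb{R}^d$ be a rational polytope. Then the function $n\mapsto\mathrm{aw}(nP)$, for $n\in\mathbb{Z}_{\geq 0}$, is eventually quasilinear.
   Context: A rational polytope is the convex hull of finitely many points of $\mathbb{Q}^d$. For a convex body $K$ and nonzero $c\in\mathbb{Z}^d$, let $h_c(K)$ be the set of hyperplanes $H$ with normal vector $c$ such that $H\cap K\cap\mathbb{Z}^d\neq\emptyset$; the arithmetic width of $K$ in direction $c$ is $\mathrm{aw}_c(K)=|h_c(K)|$ (the number of distinct values of $c^Tx$ over $x\in K\cap\mathbb{Z}^d$), and the arithmetic width of $K$ is $\mathrm{aw}(K)=\min_{c\in\mathbb{Z}^d\setminus\{0\}}\mathrm{aw}_c(K)$. A function $f:\mathbb{Z}_{\geq0}\to\mathbb{Z}$ is eventually quasilinear if there exist a positive integer $p$, an integer $N$, and rational numbers $a_0,\dots,a_{p-1},b_0,\dots,b_{p-1}$ such that $f(n)=a_in+b_i$ whenever $n\geq N$ and $n\equiv i\pmod p$. *)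

theory Defs
  imports "HOL-Analysis.Analysis" "HOL-Number_Theory.Cong"
begin

definition integer_points :: "(real ^ 'd) set"
  where "integer_points = {x. \<forall>i. x $ i \<in> \<int>}"

definition rational_points :: "(real ^ 'd) set"
  where "rational_points = {x. \<forall>i. x $ i \<in> \<rat>}"

definition rational_polytope :: "(real ^ 'd) set \<Rightarrow> bool"
  where "rational_polytope P \<longleftrightarrow>
    (\<exists>V. finite V \<and> V \<subseteq> rational_points \<and> P = convex hull V)"

definition lattice_hyperplanes :: "real ^ 'd \<Rightarrow> (real ^ 'd) set \<Rightarrow> (real ^ 'd) set set"
  where "lattice_hyperplanes c K =
    {H. (\<exists>b. H = {x. c \<bullet> x = b}) \<and> H \<inter> K \<inter> integer_points \<noteq> {}}"

(* For bounded K the set of hyperplanes is finite, so card is its true cardinality;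
   for unbounded K the value may be the junk value 0. *)
definition arith_width_dir :: "real ^ 'd \<Rightarrow> (real ^ 'd) set \<Rightarrow> nat"
  where "arith_width_dir c K = card (lattice_hyperplanes c K)"

(* An infimum over a nonempty set of natural numbers, hence an attained minimum. *)
definition arith_width :: "(real ^ 'd) set \<Rightarrow> nat"
  where "arith_width K = (INF c \<in> integer_points - {0}. arith_width_dir c K)"

definition eventually_quasilinear :: "(nat \<Rightarrow> int) \<Rightarrow> bool"
  where "eventually_quasilinear f \<longleftrightarrow>
    (\<exists>(p::nat) (N::int) (a::nat \<Rightarrow> rat) (b::nat \<Rightarrow> rat). p > 0 \<and>
      (\<forall>n. \<forall>i<p. int n \<ge> N \<longrightarrow> [n = i] (mod p) \<longrightarrow>
        rat_of_int (f n) = a i * rat_of_nat n + b i))"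

end

(*
For a direction c let S n be the set of values of c on the integer points of nP. By convexity
S m + S n is contained in S (m + n). Let k be a common denominator of the vertices, so that S k
contains both ends a <= b of its range. Splitting S n at a point and moving the two parts by a and
b respectively shows that card (S (n + k)) - card (S n) is at least the number of elements of S n
in a window of length b - a; comparison with the trivial upper bound makes this difference
eventually constant.

If P has nonempty interior, finitely many directions suffice for all large n. Indeed, if two
coordinates of c satisfy no integer relation with coefficients bounded by M, then a box of side M
in a dilate of P yields (M + 1)^2 values, and sumset growth beats any coordinate direction once M
is large. All other c lie on finitely many lines through the origin. The recurrences all have the
same period k, so they survive taking the minimum.

If P has empty interior, some integer direction is constant on P, so the width is 0 or 1 according
to whether nP contains an integer point, a property inherited by (n + k)P.
*)

theory Submission
  imports Defs
begin

subsection \<open>Eventually recurrent sequences\<close>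

text \<open>A single increment \<open>D\<close> serves all residues modulo \<open>k\<close>, which
  is more than eventual quasilinearity asks. The period is a parameter so that several sequences can
  be compared along the same steps.\<close>

definition eventually_recurrent :: "nat \<Rightarrow> (nat \<Rightarrow> nat) \<Rightarrow> bool"
  where "eventually_recurrent k f \<longleftrightarrow> (\<exists>D N. \<forall>n\<ge>N. f (n + k) = f n + D)"

lemma recurrence_iterate:
  fixes f :: "nat \<Rightarrow> nat"
  assumes "\<And>n. n \<ge> N \<Longrightarrow> f (n + k) = f n + D" and "n \<ge> N"
  shows "f (n + t * k) = f n + t * D"
proof (induction t)
  case (Suc t)
  have "f (n + Suc t * k) = f ((n + t * k) + k)" by (simp add: algebra_simps)
  also have "\<dots> = f (n + t * k) + D" using assms by (intro assms(1)) simp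
  finally show ?case using Suc by simp
qed simp

lemma eventually_recurrent_imp_quasilinear:
  assumes "k > 0" and "eventually_recurrent k f"
  shows "eventually_quasilinear (\<lambda>n. int (f n))"
proof -
  obtain D N where rec: "\<And>n. n \<ge> N \<Longrightarrow> f (n + k) = f n + D"
    using assms(2) unfolding eventually_recurrent_def by blast
  define a :: "nat \<Rightarrow> rat" where "a = (\<lambda>i. of_nat D / of_nat k)"
  \<comment> \<open>\<open>i + N * k\<close> is a representative of the class of \<open>i\<close>
    that already lies in the recurrent range; the line of slope \<open>D / k\<close> is anchored
    there.\<close>
  define b :: "nat \<Rightarrow> rat"
    where "b = (\<lambda>i. of_nat (f (i + N * k)) - of_nat (i + N * k) * (of_nat D / of_nat k))"
  have "rat_of_int (int (f n)) = a i * rat_of_nat n + b i"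
    if "i < k" "int n \<ge> int (N * k)" "[n = i] (mod k)" for n i
  proof -
    have "n mod k = i" using that by (simp add: cong_def)
    have ge: "n div k \<ge> N" using that(2) assms(1)
      by (metis div_le_mono nonzero_mult_div_cancel_right not_gr_zero of_nat_le_iff)
    define t where "t = n div k - N"
    have n: "n = (i + N * k) + t * k"
    proof -
      have "n = i + (n div k) * k" using \<open>n mod k = i\<close> by (metis add.commute div_mult_mod_eq)
      also have "n div k = N + t" using ge by (simp add: t_def)
      finally show ?thesis by (simp add: algebra_simps)
    qed
    have "N * 1 \<le> N * k" using assms(1) by (intro mult_le_mono2) simp
    then have "N \<le> i + N * k" by linarith
    then have "f n = f (i + N * k) + t * D"
      unfolding n by (intro recurrence_iterate[of N f k D] rec) simp_all
    moreover have "a i * rat_of_nat n + b i = of_nat (f (i + N * k)) + of_nat t * of_nat D"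
      using assms(1) unfolding a_def b_def by (subst n) (simp add: field_simps)
    ultimately show ?thesis by simp
  qed
  then show ?thesis
    unfolding eventually_quasilinear_def using assms(1) by blast
qed

text \<open>With \<open>H n = f n - D * (n div k)\<close>, the sum of \<open>H\<close> over \<open>k\<close> consecutive arguments starting
  at \<open>n\<close> increases by exactly \<open>H (n + k) - H n\<close>; being monotone and bounded it stabilises.\<close>
lemma eventually_recurrentI:
  fixes f :: "nat \<Rightarrow> nat"
  assumes k: "k > 0"
    and grow: "\<And>n. n \<ge> N \<Longrightarrow> f n + D \<le> f (n + k)"
    and bound: "\<And>n. f n \<le> D * (n div k) + E"
  shows "eventually_recurrent k f"
proof -
  define H where "H n = int (f n) - int D * int (n div k)" for n
  define \<Phi> where "\<Phi> n = (\<Sum>i<k. H (n + i))" for n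
  have Hk: "H (n + k) - H n = int (f (n + k)) - int (f n) - int D" for n
    using k by (simp add: H_def algebra_simps)
  have \<Phi>: "\<Phi> (Suc n) - \<Phi> n = H (n + k) - H n" for n
    using sum.lessThan_Suc[of "\<lambda>i. H (n + i)" k] sum.lessThan_Suc_shift[of "\<lambda>i. H (n + i)" k]
    by (simp add: \<Phi>_def)
  have mono: "\<Phi> n \<le> \<Phi> (Suc n)" if "n \<ge> N" for n
    using \<Phi>[of n] Hk[of n] grow[OF that] by simp
  have H_le: "H n \<le> int E" for n
  proof -
    have "int (f n) \<le> int (D * (n div k) + E)" using bound[of n] by (simp only: of_nat_le_iff)
    then show ?thesis by (simp add: H_def)
  qed
  have \<Phi>_le: "\<Phi> n \<le> int k * int E" for n
    using sum_bounded_above[of "{..<k}" "\<lambda>i. H (n + i)" "int E"] H_le by (simp add: \<Phi>_def)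
  \<comment> \<open>The distance of \<open>\<Phi>\<close> to its upper bound is a natural number, so
    it has a minimiser \<open>n0\<close>; there \<open>\<Phi>\<close> takes its maximum, and by
    monotonicity it is constant from then on.\<close>
  obtain n0 where n0: "n0 \<ge> N"
    and least: "\<And>n. n \<ge> N \<Longrightarrow> nat (int k * int E - \<Phi> n0) \<le> nat (int k * int E - \<Phi> n)"
    using ex_has_least_nat[of "\<lambda>n. n \<ge> N" N "\<lambda>n. nat (int k * int E - \<Phi> n)"] by auto
  have ge: "\<Phi> n \<ge> \<Phi> n0" if "n \<ge> n0" for n
    using that
  proof (induction n rule: dec_induct)
    case (step m)
    then show ?case using mono[of m] n0 by simp
  qed simp
  have le: "\<Phi> n \<le> \<Phi> n0" if "n \<ge> N" for n
    using least[OF that] \<Phi>_le[of n] \<Phi>_le[of n0] by linarith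
  have "f (n + k) = f n + D" if "n \<ge> n0" for n
    using ge[of n] ge[of "Suc n"] le[of n] le[of "Suc n"] \<Phi>[of n] Hk[of n] that n0 by simp
  then show ?thesis unfolding eventually_recurrent_def by blast
qed

text \<open>Every large \<open>n\<close> is reached in \<open>t\<close> periods from a start in
  \<open>{N..<N + k}\<close>, where \<open>f\<close> is at most \<open>B\<close>. Each period gains
  \<open>g\<close> at least one on \<open>f\<close>, so \<open>t \<ge> B\<close> periods are
  enough.\<close>

lemma recurrence_dominates:
  fixes f g :: "nat \<Rightarrow> nat"
  assumes k: "k > 0" and "D < D'"
    and f: "\<And>n. n \<ge> N \<Longrightarrow> f (n + k) = f n + D"
    and g: "\<And>n. n \<ge> N \<Longrightarrow> g (n + k) = g n + D'"
  shows "\<exists>N'. \<forall>n\<ge>N'. f n \<le> g n"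
proof -
  define B where "B = Max (f ` {N..<N + k})"
  have "f n \<le> g n" if "n \<ge> N + B * k" for n
  proof -
    define t where "t = (n - N) div k"
    define m where "m = N + (n - N) mod k"
    have n: "n = m + t * k"
      using that div_mult_mod_eq[of "n - N" k] unfolding t_def m_def by linarith
    have m: "m \<ge> N" "m < N + k" using k by (auto simp: m_def)
    have "(B * k) div k \<le> t" unfolding t_def using that by (intro div_le_mono) linarith
    then have t: "B \<le> t" using k by simp
    have "f m \<le> B" unfolding B_def using m by (intro Max_ge) auto
    moreover have "t * Suc D \<le> t * D'" using assms(2) by (intro mult_le_mono2) simp
    moreover have "f n = f m + t * D" unfolding n by (intro recurrence_iterate[of N f] f m(1))
    moreover have "g n = g m + t * D'" unfolding n by (intro recurrence_iterate[of N g] g m(1))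
    ultimately show ?thesis using t by simp
  qed
  then show ?thesis by blast
qed

lemma eventually_recurrent_cong:
  assumes "eventually_recurrent k f" and "\<And>n. n \<ge> N \<Longrightarrow> g n = f n"
  shows "eventually_recurrent k g"
proof -
  obtain D N' where "\<And>n. n \<ge> N' \<Longrightarrow> f (n + k) = f n + D"
    using assms(1) unfolding eventually_recurrent_def by blast
  then have "\<forall>n\<ge>max N N'. g (n + k) = g n + D" using assms(2) by simp
  then show ?thesis unfolding eventually_recurrent_def by blast
qed

text \<open>With equal increments the minimum inherits the recurrence; otherwise the sequence with
  the smaller increment is eventually the minimum.\<close>

lemma eventually_recurrent_min:
  assumes k: "k > 0" and f: "eventually_recurrent k f" and g: "eventually_recurrent k g"
  shows "eventually_recurrent k (\<lambda>n. min (f n) (g n))"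
proof -
  obtain D N where "\<And>n. n \<ge> N \<Longrightarrow> f (n + k) = f n + D"
    using f unfolding eventually_recurrent_def by blast
  moreover obtain D' N' where "\<And>n. n \<ge> N' \<Longrightarrow> g (n + k) = g n + D'"
    using g unfolding eventually_recurrent_def by blast
  ultimately have rec: "\<And>n. n \<ge> max N N' \<Longrightarrow> f (n + k) = f n + D"
    "\<And>n. n \<ge> max N N' \<Longrightarrow> g (n + k) = g n + D'" by simp_all
  consider "D = D'" | "D < D'" | "D' < D" by linarith
  then show ?thesis
  proof cases
    case 1
    then have "\<forall>n\<ge>max N N'. min (f (n + k)) (g (n + k)) = min (f n) (g n) + D"
      using rec by (simp add: min_add_distrib_left)
    then show ?thesis unfolding eventually_recurrent_def by blast
  next
    case 2
    obtain M where "\<And>n. n \<ge> M \<Longrightarrow> f n \<le> g n" using recurrence_dominates[of k D D' "max N N'" f g, OF k 2 rec] by blast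
    then show ?thesis by (intro eventually_recurrent_cong[OF f, of M]) simp
  next
    case 3
    obtain M where "\<And>n. n \<ge> M \<Longrightarrow> g n \<le> f n"
      using recurrence_dominates[of k D' D "max N N'" g f, OF k 3 rec(2,1)] by blast
    then show ?thesis by (intro eventually_recurrent_cong[OF g, of M]) simp
  qed
qed

lemma eventually_recurrent_Min:
  assumes "k > 0" and "finite G" and "G \<noteq> {}" and "\<And>f. f \<in> G \<Longrightarrow> eventually_recurrent k f"
  shows "eventually_recurrent k (\<lambda>n. Min ((\<lambda>f. f n) ` G))"
  using assms(2-4)
proof (induction G rule: finite_ne_induct)
  case (insert f G)
  then show ?case using assms(1) by (simp add: eventually_recurrent_min)
qed simp

subsection \<open>Superadditive families of integer sets\<close>

text \<open>Models the values of one direction on the integer points of the dilates of a convex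
  body.\<close>

locale superadditive_sets =
  fixes S :: "nat \<Rightarrow> int set"
  assumes finite_S [simp]: "finite (S n)"
    and add_mem: "x \<in> S m \<Longrightarrow> y \<in> S n \<Longrightarrow> x + y \<in> S (m + n)"
begin

text \<open>The sumset bound |A + B| >= |A| + |B| - 1 for integers: the translate of
  \<open>S m\<close> by the minimum of \<open>S n\<close> and the translate of \<open>S n\<close> by
  the maximum of \<open>S m\<close> meet in at most one point.\<close>

lemma card_add:
  assumes "S m \<noteq> {}" and "S n \<noteq> {}"
  shows "card (S m) + card (S n) \<le> Suc (card (S (m + n)))"
proof -
  define A where "A = (\<lambda>x. x + Min (S n)) ` S m"
  define B where "B = (\<lambda>y. Max (S m) + y) ` S n"
  have "A \<union> B \<subseteq> S (m + n)"
    using add_mem[OF _ Min_in[OF finite_S assms(2)]] add_mem[OF Max_in[OF finite_S assms(1)]]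
    by (auto simp: A_def B_def)
  then have "card (A \<union> B) \<le> card (S (m + n))" by (intro card_mono) simp_all
  moreover have "A \<inter> B \<subseteq> {Max (S m) + Min (S n)}"
  proof
    fix z assume "z \<in> A \<inter> B"
    then obtain x y where "x \<in> S m" "y \<in> S n" "z = x + Min (S n)" "z = Max (S m) + y"
      unfolding A_def B_def by blast
    moreover from this have "x \<le> Max (S m)" "Min (S n) \<le> y" by simp_all
    ultimately have "z = Max (S m) + Min (S n)" by linarith
    then show "z \<in> {Max (S m) + Min (S n)}" by simp
  qed
  then have "card (A \<inter> B) \<le> card {Max (S m) + Min (S n)}" by (intro card_mono) simp_all
  moreover have "card A = card (S m)" "card B = card (S n)"
    unfolding A_def B_def by (intro card_image; simp add: inj_on_def)+
  moreover have "card A + card B = card (A \<union> B) + card (A \<inter> B)"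
    by (intro card_Un_Int) (simp_all add: A_def B_def)
  ultimately show ?thesis by simp
qed

text \<open>Iterates \<open>card_add\<close>: each further summand \<open>S m\<close> contributes
  \<open>card (S m) - 1\<close>. Nonemptiness is part of the conclusion because the induction step
  needs it.\<close>

lemma card_mult_add:
  assumes "S m \<noteq> {}" and "S r \<noteq> {}"
  shows "t * (card (S m) - 1) + card (S r) \<le> card (S (t * m + r)) \<and> S (t * m + r) \<noteq> {}"
proof (induction t)
  case 0
  then show ?case using assms by simp
next
  case (Suc t)
  have eq: "Suc t * m + r = m + (t * m + r)" by simp
  have "card (S m) + card (S (t * m + r)) \<le> Suc (card (S (m + (t * m + r))))"
    using Suc by (intro card_add assms) simp
  moreover have "card (S m) > 0" using assms by (simp add: card_gt_0_iff)
  moreover have "S (m + (t * m + r)) \<noteq> {}" using Suc assms add_mem by blast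
  moreover have "Suc t * (card (S m) - 1) = t * (card (S m) - 1) + (card (S m) - 1)" by simp
  ultimately show ?case using Suc unfolding eq by linarith
qed

text \<open>The set \<open>S n\<close> is cut at \<open>m\<close>: the part below is translated by \<open>a\<close>, the part from \<open>m\<close> on
  by \<open>b\<close>, and the gap \<open>{m + a..<m + b}\<close> receives a translated window.\<close>
lemma card_window:
  assumes a: "a \<in> S k" and b: "b \<in> S k" and "a \<le> b"
  shows "card (S n) + card (S n \<inter> {m..<m + (b - a)}) \<le> card (S (n + k))"
proof -
  define L where "L = (\<lambda>x. x + a) ` (S n \<inter> {..<m})"
  define W where "W = (\<lambda>x. x + a) ` (S n \<inter> {m..<m + (b - a)})"
  define U where "U = (\<lambda>x. x + b) ` (S n \<inter> {m..})"
  have "card (L \<union> W \<union> U) = card (L \<union> W) + card U"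
    using \<open>a \<le> b\<close> by (intro card_Un_disjoint) (auto simp: L_def W_def U_def)
  also have "card (L \<union> W) = card L + card W"
    using \<open>a \<le> b\<close> by (intro card_Un_disjoint) (auto simp: L_def W_def)
  also have "card L = card (S n \<inter> {..<m})"
    unfolding L_def by (intro card_image) (simp add: inj_on_def)
  also have "card W = card (S n \<inter> {m..<m + (b - a)})"
    unfolding W_def by (intro card_image) (simp add: inj_on_def)
  also have "card U = card (S n \<inter> {m..})"
    unfolding U_def by (intro card_image) (simp add: inj_on_def)
  finally have "card (L \<union> W \<union> U) =
    card (S n \<inter> {..<m}) + card (S n \<inter> {m..<m + (b - a)}) + card (S n \<inter> {m..})" .
  moreover have "card (S n) = card (S n \<inter> {..<m}) + card (S n \<inter> {m..})"
  proof (subst card_Un_disjoint [symmetric])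
    show "card (S n) = card (S n \<inter> {..<m} \<union> S n \<inter> {m..})"
      by (rule arg_cong[of _ _ card]) auto
  qed auto
  moreover have "card (L \<union> W \<union> U) \<le> card (S (n + k))"
    by (intro card_mono) (auto simp: L_def W_def U_def intro: add_mem a b)
  ultimately show ?thesis by simp
qed

text \<open>The slope is the largest number \<open>D\<close> of elements in a window of length \<open>b - a\<close>. The maximum
  is attained in translates for all large \<open>n\<close>, and covering \<open>S n\<close> by windows bounds its size.\<close>
lemma eventually_recurrent_card:
  assumes k: "k > 0" and a: "a \<in> S k" and b: "b \<in> S k"
    and range: "\<And>n x. x \<in> S n \<Longrightarrow> int n * a \<le> int k * x \<and> int k * x \<le> int n * b"
    and ne: "\<And>n. n \<ge> N \<Longrightarrow> S n \<noteq> {}"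
  shows "eventually_recurrent k (\<lambda>n. card (S n))"
proof -
  define w where "w = b - a"
  have "int k * a \<le> int k * b" using range[OF a] by simp
  then have "a \<le> b" using k by simp
  then have w: "w \<ge> 0" by (simp add: w_def)
  define win where "win n m = card (S n \<inter> {m..<m + w})" for n m
  have win_le: "win n m \<le> nat w" for n m
  proof -
    have "win n m \<le> card {m..<m + w}" unfolding win_def by (intro card_mono) auto
    then show ?thesis by simp
  qed
  \<comment> \<open>The maximum exists because a window of \<open>w\<close> integers never holds
    more than \<open>nat w\<close> elements.\<close>
  define D where "D = Max (range (\<lambda>(n, m). win n m))"
  have fin: "finite (range (\<lambda>(n, m). win n m))"
    by (rule finite_subset[of _ "{..nat w}"]) (use win_le in auto)
  have D_ge: "win n m \<le> D" for n m
    unfolding D_def by (rule Max_ge[OF fin]) auto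
  have "D \<in> range (\<lambda>(n, m). win n m)" unfolding D_def by (rule Max_in[OF fin]) auto
  then obtain n0 m0 where D: "D = win n0 m0" by auto
  have grow: "card (S n) + D \<le> card (S (n + k))" if "n \<ge> N + n0" for n
  proof -
    have "S (n - n0) \<noteq> {}" using that by (intro ne) simp
    \<comment> \<open>Translation by \<open>s\<close> carries the optimal window of
      \<open>S n0\<close> into \<open>S n\<close>, so every later \<open>n\<close> has a window with
      at least \<open>D\<close> elements.\<close>
    then obtain s where s: "s \<in> S (n - n0)" by blast
    have "(\<lambda>x. x + s) ` (S n0 \<inter> {m0..<m0 + w}) \<subseteq> S n \<inter> {m0 + s..<m0 + s + w}"
      using add_mem[OF _ s, of _ n0] that by auto
    then have "card ((\<lambda>x. x + s) ` (S n0 \<inter> {m0..<m0 + w})) \<le> win n (m0 + s)"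
      unfolding win_def by (intro card_mono) simp_all
    moreover have "card ((\<lambda>x. x + s) ` (S n0 \<inter> {m0..<m0 + w})) = D"
      unfolding D win_def by (intro card_image) (simp add: inj_on_def)
    ultimately show ?thesis
      using card_window[OF a b \<open>a \<le> b\<close>, of n "m0 + s"] by (simp add: win_def w_def)
  qed
  have bound: "card (S n) \<le> D * (n div k) + (2 * D + 1)" for n
  proof (cases "w = 0")
    \<comment> \<open>Windows are empty here, but the range hypothesis leaves at most one element in
      \<open>S n\<close>; the \<open>+ 1\<close> in the bound covers it.\<close>
    case True
    then have "a = b" by (simp add: w_def)
    have "x = y" if "x \<in> S n" "y \<in> S n" for x y
    proof -
      have "int k * x = int k * y" using range[OF that(1)] range[OF that(2)] \<open>a = b\<close> by force
      then show ?thesis using k by simp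
    qed
    then have "card (S n) \<le> Suc 0" by (subst card_le_Suc0_iff_eq) auto
    then show ?thesis by simp
  next
    case False
    then have w: "w > 0" using w by simp
    \<comment> \<open>Windows are laid out from the rounded left end \<open>n * a / k\<close>.
      Besides \<open>n div k\<close> of them, one is spent on the remainder of \<open>n\<close>
      modulo \<open>k\<close> and one on the rounding.\<close>
    define l where "l = (int n * a) div int k"
    have "S n \<subseteq> (\<Union>i\<in>{..n div k + 1}. S n \<inter> {l + int i * w..<l + int i * w + w})"
    proof
      fix x assume x: "x \<in> S n"
      define i where "i = (x - l) div w"
      have lx: "l \<le> x"
      proof -
        have "l \<le> (int k * x) div int k" unfolding l_def
          using range[OF x] k by (intro zdiv_mono1) simp_all
        then show ?thesis using k by simp
      qed
      then have i0: "i \<ge> 0" unfolding i_def using w by (simp add: pos_imp_zdiv_nonneg_iff)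
      have "int k * l > int n * a - int k"
        unfolding l_def using k pos_mod_bound[of "int k" "int n * a"]
        by (simp add: minus_mod_eq_mult_div [symmetric])
      then have less: "int k * (x - l) < int n * w + int k"
        using range[OF x] by (simp add: w_def algebra_simps)
      have n_le: "int n * w \<le> (int k * int (n div k) + int k) * w"
      proof (intro mult_right_mono)
        have "n \<le> k * (n div k) + k"
          using k by (metis less_imp_le_nat mod_less_divisor mult_div_mod_eq nat_add_left_cancel_le)
        then show "int n \<le> int k * int (n div k) + int k"
          by (metis of_nat_add of_nat_le_iff of_nat_mult)
      qed (use w in simp)
      have "int k \<le> int k * w" using w mult_left_mono[of 1 w "int k"] by simp
      with less n_le have "int k * (x - l) < (int k * int (n div k) + int k) * w + int k * w"
        by linarith
      also have "\<dots> = int k * ((int (n div k) + 2) * w)" by (simp add: algebra_simps)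
      finally have "int k * (x - l) < int k * ((int (n div k) + 2) * w)" .
      then have "x - l < (int (n div k) + 2) * w" using k by simp
      moreover have "i * w \<le> x - l"
        using div_mult_mod_eq[of "x - l" w] pos_mod_sign[OF w, of "x - l"]
        unfolding i_def by linarith
      ultimately have "i * w < (int (n div k) + 2) * w" by linarith
      then have "i < int (n div k) + 2" using w by simp
      then have "nat i \<le> n div k + 1" using i0 by simp
      moreover have "x \<in> {l + i * w..<l + i * w + w}"
        using div_mult_mod_eq[of "x - l" w] pos_mod_bound[OF w, of "x - l"]
          pos_mod_sign[OF w, of "x - l"]
        unfolding i_def atLeastLessThan_iff by linarith
      ultimately show "x \<in> (\<Union>i\<in>{..n div k + 1}. S n \<inter> {l + int i * w..<l + int i * w + w})"
        using x i0 by (intro UN_I[of "nat i"]) auto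
    qed
    then have "card (S n) \<le> card (\<Union>i\<in>{..n div k + 1}. S n \<inter> {l + int i * w..<l + int i * w + w})"
      by (intro card_mono) simp_all
    also have "\<dots> \<le> (\<Sum>i\<in>{..n div k + 1}. win n (l + int i * w))"
      unfolding win_def by (intro card_UN_le) simp
    also have "\<dots> \<le> (\<Sum>i\<in>{..n div k + 1}. D)" by (intro sum_mono D_ge)
    finally show ?thesis by (simp add: algebra_simps)
  qed
  show ?thesis by (rule eventually_recurrentI[OF k grow bound])
qed

end

subsection \<open>Lattice values of dilates\<close>

abbreviation dilate :: "nat \<Rightarrow> (real ^ 'd) set \<Rightarrow> (real ^ 'd) set"
  where "dilate n P \<equiv> (\<lambda>x. real n *\<^sub>R x) ` P"

text \<open>Replaces hyperplanes by their integer offsets. For integral \<open>c\<close> no offset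
  is lost, since \<open>c\<close> takes integer values on integer points.\<close>

definition lattice_values :: "real ^ 'd \<Rightarrow> (real ^ 'd) set \<Rightarrow> int set"
  where "lattice_values c K = {z. \<exists>x \<in> K \<inter> integer_points. c \<bullet> x = of_int z}"

lemma integer_points_add: "x \<in> integer_points \<Longrightarrow> y \<in> integer_points \<Longrightarrow> x + y \<in> integer_points"
  by (simp add: integer_points_def)

lemma inner_integer_points:
  assumes "c \<in> integer_points" and "x \<in> integer_points"
  shows "c \<bullet> x \<in> \<int>"
  using assms by (auto simp: inner_vec_def integer_points_def intro!: Ints_sum)

lemma arith_width_dir_eq_card:
  assumes "c \<in> integer_points" and "c \<noteq> 0"
  shows "arith_width_dir c K = card (lattice_values c K)"
proof -
  let ?H = "\<lambda>z::int. {x. c \<bullet> x = of_int z}"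
  have "inj ?H"
  proof
    fix y z assume "?H y = ?H z"
    \<comment> \<open>A point of the hyperplane with offset \<open>y\<close>, taken on the line
      spanned by \<open>c\<close>; it separates different offsets.\<close>
    moreover have "(of_int y / (c \<bullet> c)) *\<^sub>R c \<in> ?H y" using assms(2) by simp
    ultimately have "(of_int y / (c \<bullet> c)) *\<^sub>R c \<in> ?H z" by (rule subst)
    then show "y = z" using assms(2) by simp
  qed
  then have "card (?H ` lattice_values c K) = card (lattice_values c K)"
    by (intro card_image) (rule inj_on_subset, auto)
  moreover have "lattice_hyperplanes c K = ?H ` lattice_values c K"
  proof (intro equalityI subsetI)
    fix H assume "H \<in> lattice_hyperplanes c K"
    then obtain b x where H: "H = {x. c \<bullet> x = b}" "x \<in> K" "x \<in> integer_points" "c \<bullet> x = b"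
      unfolding lattice_hyperplanes_def by blast
    then obtain z where "b = of_int z"
      using inner_integer_points[OF assms(1) H(3)] by (auto elim: Ints_cases)
    then show "H \<in> ?H ` lattice_values c K"
      using H by (auto simp: lattice_values_def)
  next
    fix H assume "H \<in> ?H ` lattice_values c K"
    then show "H \<in> lattice_hyperplanes c K"
      unfolding lattice_hyperplanes_def lattice_values_def by blast
  qed
  ultimately show ?thesis by (simp add: arith_width_dir_def)
qed

text \<open>Allows a direction to be normalised to have a coordinate equal to 1, even if integrality
  is lost.\<close>

lemma arith_width_dir_scaleR:
  assumes "t \<noteq> 0"
  shows "arith_width_dir (t *\<^sub>R c) K = arith_width_dir c K"
proof -
  have "(\<exists>b. H = {x. (t *\<^sub>R c) \<bullet> x = b}) \<longleftrightarrow> (\<exists>b. H = {x. c \<bullet> x = b})" for H :: "(real ^ 'a) set"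
  proof
    assume "\<exists>b. H = {x. (t *\<^sub>R c) \<bullet> x = b}"
    then obtain b where "H = {x. (t *\<^sub>R c) \<bullet> x = b}" ..
    then have "H = {x. c \<bullet> x = b / t}" using assms by (auto simp: field_simps)
    then show "\<exists>b. H = {x. c \<bullet> x = b}" ..
  next
    assume "\<exists>b. H = {x. c \<bullet> x = b}"
    then obtain b where "H = {x. c \<bullet> x = b}" ..
    then have "H = {x. (t *\<^sub>R c) \<bullet> x = t * b}" using assms by auto
    then show "\<exists>b. H = {x. (t *\<^sub>R c) \<bullet> x = b}" ..
  qed
  then show ?thesis by (simp add: arith_width_dir_def lattice_hyperplanes_def)
qed

lemma common_denominator:
  assumes "finite (X :: real set)" and "X \<subseteq> \<rat>"
  shows "\<exists>k::nat>0. \<forall>x\<in>X. real k * x \<in> \<int>"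
  using assms
proof (induction X)
  case (insert x X)
  then obtain k :: nat where k: "k > 0" "\<forall>x\<in>X. real k * x \<in> \<int>" by auto
  obtain m n :: int where "n > 0" "x = of_int m / of_int n"
    using insert.prems by (auto elim: Rats_cases')
  then have n: "nat n > 0" "real (nat n) * x \<in> \<int>" by simp_all
  have "real (k * nat n) * y \<in> \<int>" if "y \<in> insert x X" for y
  proof (cases "y = x")
    case True
    have "real (k * nat n) * y = real k * (real (nat n) * x)" by (simp add: True)
    then show ?thesis using n(2) by (metis Ints_mult Ints_of_nat)
  next
    case False
    have "real (k * nat n) * y = real (nat n) * (real k * y)" by simp
    then show ?thesis using that False k(2) by (metis Ints_mult Ints_of_nat insertE)
  qed
  then show ?case using k(1) n(1) by (intro exI[of _ "k * nat n"]) auto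
qed auto

lemma common_denominator_vec:
  fixes V :: "(real ^ 'd) set"
  assumes "finite V" and "V \<subseteq> rational_points"
  shows "\<exists>k::nat>0. \<forall>v\<in>V. real k *\<^sub>R v \<in> integer_points"
proof -
  have "finite ((\<lambda>(v, i). v $ i) ` (V \<times> UNIV))" using assms(1) by simp
  moreover have "(\<lambda>(v, i). v $ i) ` (V \<times> UNIV) \<subseteq> \<rat>"
    using assms(2) by (auto simp: rational_points_def)
  ultimately obtain k :: nat
    where "k > 0" "\<forall>x \<in> (\<lambda>(v, i). v $ i) ` (V \<times> UNIV). real k * x \<in> \<int>"
    using common_denominator by meson
  then show ?thesis by (intro exI[of _ k]) (auto simp: integer_points_def)
qed

text \<open>The sum of \<open>m\<close> times \<open>p\<close> and \<open>n\<close> times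
  \<open>q\<close> is \<open>m + n\<close> times their weighted mean, which convexity keeps in
  \<open>P\<close>. Both factors being zero leaves no weights and is treated apart.\<close>

lemma dilate_add:
  assumes "convex P" and "x \<in> dilate m P" and "y \<in> dilate n P"
  shows "x + y \<in> dilate (m + n) P"
proof -
  obtain p q where p: "p \<in> P" "x = real m *\<^sub>R p" and q: "q \<in> P" "y = real n *\<^sub>R q"
    using assms(2,3) by auto
  show ?thesis
  proof (cases "m + n = 0")
    case True
    then show ?thesis using p q by auto
  next
    case False
    then have pos: "real m + real n > 0" by linarith
    let ?z = "(real m / (real m + real n)) *\<^sub>R p + (real n / (real m + real n)) *\<^sub>R q"
    have "real m / (real m + real n) + real n / (real m + real n) = 1"
      using pos by (simp add: add_divide_distrib [symmetric])
    then have "?z \<in> P" using pos by (intro convexD assms(1) p q) simp_all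
    moreover have "x + y = real (m + n) *\<^sub>R ?z"
      using pos p q by (simp add: scaleR_add_right)
    ultimately show ?thesis by blast
  qed
qed

lemma finite_lattice_values:
  assumes "bounded K"
  shows "finite (lattice_values c K)"
proof -
  obtain B where B: "\<And>x. x \<in> K \<Longrightarrow> norm x \<le> B" using assms by (auto simp: bounded_iff)
  have "lattice_values c K \<subseteq> {- \<lceil>norm c * B\<rceil>..\<lceil>norm c * B\<rceil>}"
  proof
    fix z assume "z \<in> lattice_values c K"
    then obtain x where x: "x \<in> K" "c \<bullet> x = of_int z" by (auto simp: lattice_values_def)
    have "\<bar>c \<bullet> x\<bar> \<le> norm c * norm x" by (rule Cauchy_Schwarz_ineq2)
    also have "\<dots> \<le> norm c * B" using B[OF x(1)] by (intro mult_left_mono) simp_all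
    finally have "real_of_int \<bar>z\<bar> \<le> norm c * B" using x by simp
    then have "\<bar>z\<bar> \<le> \<lceil>norm c * B\<rceil>" by linarith
    then show "z \<in> {- \<lceil>norm c * B\<rceil>..\<lceil>norm c * B\<rceil>}" by auto
  qed
  then show ?thesis by (rule finite_subset) simp
qed

lemma superadditive_lattice_values:
  assumes "convex P" and "bounded P"
  shows "superadditive_sets (\<lambda>n. lattice_values c (dilate n P))"
proof
  show "finite (lattice_values c (dilate n P))" for n
    by (intro finite_lattice_values bounded_scaling assms(2))
next
  fix y z m n
  assume "y \<in> lattice_values c (dilate m P)" and "z \<in> lattice_values c (dilate n P)"
  then obtain p q where "p \<in> dilate m P" "p \<in> integer_points" "c \<bullet> p = of_int y"
    "q \<in> dilate n P" "q \<in> integer_points" "c \<bullet> q = of_int z"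
    unfolding lattice_values_def by blast
  moreover from this have "p + q \<in> dilate (m + n) P" by (intro dilate_add assms(1))
  ultimately have "p + q \<in> dilate (m + n) P \<inter> integer_points" "c \<bullet> (p + q) = of_int (y + z)"
    by (simp_all add: inner_add_right integer_points_add)
  then show "y + z \<in> lattice_values c (dilate (m + n) P)"
    unfolding lattice_values_def by blast
qed

text \<open>A linear functional attains its extremes over the hull at vertices \<open>u\<close> and
  \<open>v\<close>. As \<open>k\<close> clears denominators, the values \<open>a\<close> and
  \<open>b\<close> at their \<open>k\<close>-fold multiples lie in the set for \<open>k\<close>, and
  they bound all other sets proportionally.\<close>

lemma eventually_recurrent_arith_width_dir:
  fixes V :: "(real ^ 'd) set"
  assumes V: "finite V" "V \<noteq> {}" and k: "k > 0"
    and int: "\<And>v. v \<in> V \<Longrightarrow> real k *\<^sub>R v \<in> integer_points"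
    and c: "c \<in> integer_points" "c \<noteq> 0"
    and ne: "\<And>n. n \<ge> N \<Longrightarrow> dilate n (convex hull V) \<inter> integer_points \<noteq> {}"
  shows "eventually_recurrent k (\<lambda>n. arith_width_dir c (dilate n (convex hull V)))"
proof -
  let ?S = "\<lambda>n. lattice_values c (dilate n (convex hull V))"
  interpret superadditive_sets ?S
    using V(1) by (intro superadditive_lattice_values convex_convex_hull
        compact_imp_bounded compact_convex_hull finite_imp_compact)
  have fin: "finite ((\<bullet>) c ` V)" "(\<bullet>) c ` V \<noteq> {}" using V by simp_all
  obtain u where u: "u \<in> V" "c \<bullet> u = Min ((\<bullet>) c ` V)" using Min_in[OF fin] by fastforce
  obtain v where v: "v \<in> V" "c \<bullet> v = Max ((\<bullet>) c ` V)" using Max_in[OF fin] by fastforce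
  obtain a where a: "c \<bullet> (real k *\<^sub>R u) = of_int a"
    using inner_integer_points[OF c(1) int[OF u(1)]] by (auto elim: Ints_cases)
  obtain b where b: "c \<bullet> (real k *\<^sub>R v) = of_int b"
    using inner_integer_points[OF c(1) int[OF v(1)]] by (auto elim: Ints_cases)
  have lower: "c \<bullet> u \<le> c \<bullet> x" and upper: "c \<bullet> x \<le> c \<bullet> v" if "x \<in> convex hull V" for x
  proof -
    have "convex hull V \<subseteq> {x. c \<bullet> u \<le> c \<bullet> x}"
      using fin by (intro hull_minimal convex_halfspace_ge) (auto simp: u(2))
    then show "c \<bullet> u \<le> c \<bullet> x" using that by auto
    have "convex hull V \<subseteq> {x. c \<bullet> x \<le> c \<bullet> v}"
      using fin by (intro hull_minimal convex_halfspace_le) (auto simp: v(2))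
    then show "c \<bullet> x \<le> c \<bullet> v" using that by auto
  qed
  have "eventually_recurrent k (\<lambda>n. card (?S n))"
  proof (rule eventually_recurrent_card[OF k])
    show "a \<in> ?S k" unfolding lattice_values_def
      using a int[OF u(1)] hull_inc[OF u(1)] by (auto intro!: bexI[of _ "real k *\<^sub>R u"])
    show "b \<in> ?S k" unfolding lattice_values_def
      using b int[OF v(1)] hull_inc[OF v(1)] by (auto intro!: bexI[of _ "real k *\<^sub>R v"])
    show "int n * a \<le> int k * z \<and> int k * z \<le> int n * b" if z: "z \<in> ?S n" for n z
    proof -
      obtain x where x: "x \<in> convex hull V" "c \<bullet> (real n *\<^sub>R x) = of_int z"
        using z unfolding lattice_values_def by blast
      have "real (n * k) * (c \<bullet> u) \<le> real (n * k) * (c \<bullet> x)"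
        by (intro mult_left_mono lower x) simp
      moreover have "real (n * k) * (c \<bullet> u) = of_int (int n * a)" using a by (simp add: mult_ac)
      moreover have "real (n * k) * (c \<bullet> x) = of_int (int k * z)" using x(2) by (simp add: mult_ac)
      moreover have "real (n * k) * (c \<bullet> x) \<le> real (n * k) * (c \<bullet> v)"
        by (intro mult_left_mono upper x) simp
      moreover have "real (n * k) * (c \<bullet> v) = of_int (int n * b)" using b by (simp add: mult_ac)
      ultimately show ?thesis by (simp only: of_int_le_iff)
    qed
    show "?S n \<noteq> {}" if n: "n \<ge> N" for n
    proof -
      obtain x where x: "x \<in> dilate n (convex hull V)" "x \<in> integer_points"
        using ne[OF n] by blast
      then obtain z where "c \<bullet> x = of_int z"
        using inner_integer_points[OF c(1) x(2)] by (auto elim: Ints_cases)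
      then show ?thesis using x unfolding lattice_values_def by blast
    qed
  qed
  then show ?thesis by (simp add: arith_width_dir_eq_card[OF c])
qed

lemma arith_width_le:
  assumes "c \<in> integer_points" and "c \<noteq> 0"
  shows "arith_width K \<le> arith_width_dir c K"
  unfolding arith_width_def using assms by (intro cINF_lower) auto

subsection \<open>Polytopes with empty interior\<close>

text \<open>Applying a \<open>\<rat>\<close>-linear functional \<open>\<real> \<rightarrow> \<rat>\<close> coordinatewise preserves all linear relations
  with rational coefficients.\<close>
lemma rational_normal_vector:
  fixes a :: "real ^ 'd"
  assumes "a \<noteq> 0"
  shows "\<exists>c \<in> rational_points. c \<noteq> 0 \<and> (\<forall>w \<in> rational_points. a \<bullet> w = 0 \<longrightarrow> c \<bullet> w = 0)"
proof -
  interpret Q: vector_space_pair "\<lambda>(q::rat) (x::real). of_rat q * x" "(*) :: rat \<Rightarrow> rat \<Rightarrow> rat"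
    by unfold_locales (simp_all add: algebra_simps of_rat_add of_rat_mult)
  obtain i where i: "a $ i \<noteq> 0" using assms by (auto simp: vec_eq_iff)
  \<comment> \<open>Prescribing the value 1 at a nonzero coordinate of \<open>a\<close> ensures that
    the rational normal is nonzero.\<close>
  have "\<not> Q.vs1.dependent {a $ i}" using i by simp
  then obtain \<phi> where \<phi>: "Vector_Spaces.linear (\<lambda>(q::rat) (x::real). of_rat q * x) (*) \<phi>"
    and "\<forall>x\<in>{a $ i}. \<phi> x = 1"
    using Q.linear_independent_extend[of "{a $ i}" "\<lambda>_. 1"] by blast
  then have \<phi>i: "\<phi> (a $ i) = 1" by simp
  interpret \<phi>: Vector_Spaces.linear "\<lambda>(q::rat) (x::real). of_rat q * x" "(*)" \<phi> by (rule \<phi>)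
  define c :: "real ^ 'd" where "c = (\<chi> j. of_rat (\<phi> (a $ j)))"
  have "c \<bullet> w = 0" if w: "w \<in> rational_points" "a \<bullet> w = 0" for w
  proof -
    have "\<forall>j. \<exists>q. w $ j = of_rat q" using w(1) by (auto simp: rational_points_def elim: Rats_cases)
    then obtain q where q: "\<And>j. w $ j = of_rat (q j)" by metis
    have "0 = \<phi> (\<Sum>j\<in>UNIV. of_rat (q j) * a $ j)"
      using w(2) \<phi>.zero by (simp add: inner_vec_def q mult.commute)
    also have "\<dots> = (\<Sum>j\<in>UNIV. q j * \<phi> (a $ j))" by (simp add: \<phi>.sum \<phi>.scale)
    finally have "of_rat (\<Sum>j\<in>UNIV. q j * \<phi> (a $ j)) = (0 :: real)" by simp
    then show ?thesis by (simp add: inner_vec_def c_def q of_rat_sum of_rat_mult mult.commute)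
  qed
  moreover have "c \<noteq> 0" using \<phi>i by (auto simp: c_def vec_eq_iff intro!: exI[of _ i])
  moreover have "c \<in> rational_points" by (simp add: c_def rational_points_def)
  ultimately show ?thesis by blast
qed

text \<open>The real normal of a hyperplane containing the hull kills all differences of vertices.
  These are rational, so a rational normal kills them too, and its denominators can be
  cleared.\<close>

lemma flat_polytope_integer_normal:
  fixes V :: "(real ^ 'd) set"
  assumes V: "V \<subseteq> rational_points" and "interior (convex hull V) = {}"
  obtains c \<beta> where "c \<in> integer_points" "c \<noteq> 0" "convex hull V \<subseteq> {x. c \<bullet> x = \<beta>}"
proof -
  obtain a b where a: "a \<noteq> 0" "convex hull V \<subseteq> {x. a \<bullet> x = b}"
    using empty_interior_subset_hyperplane[OF convex_convex_hull assms(2)] by blast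
  obtain q where q: "q \<in> rational_points" "q \<noteq> 0"
    "\<And>w. w \<in> rational_points \<Longrightarrow> a \<bullet> w = 0 \<Longrightarrow> q \<bullet> w = 0"
    using rational_normal_vector[OF a(1)] by blast
  obtain k :: nat where k: "k > 0" "real k *\<^sub>R q \<in> integer_points"
    using common_denominator_vec[of "{q}"] q(1) by auto
  have "\<exists>\<beta>. convex hull V \<subseteq> {x. (real k *\<^sub>R q) \<bullet> x = \<beta>}"
  proof (cases "V = {}")
    case False
    then obtain v where v: "v \<in> V" by blast
    have "(real k *\<^sub>R q) \<bullet> x = (real k *\<^sub>R q) \<bullet> v" if "x \<in> V" for x
    proof -
      have "a \<bullet> (x - v) = 0" using a(2) hull_inc[OF that] hull_inc[OF v] by (auto simp: inner_diff_right)
      moreover have "x - v \<in> rational_points" using subsetD[OF V that] subsetD[OF V v]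
        by (simp add: rational_points_def)
      ultimately have "q \<bullet> (x - v) = 0" using q(3) by blast
      then show ?thesis by (simp add: inner_diff_right)
    qed
    then have "convex hull V \<subseteq> {x. (real k *\<^sub>R q) \<bullet> x = (real k *\<^sub>R q) \<bullet> v}"
      by (intro hull_minimal convex_hyperplane) auto
    then show ?thesis by blast
  qed simp
  then show ?thesis using that k q(2) by fastforce
qed

lemma eventually_recurrent_flat:
  fixes V :: "(real ^ 'd) set"
  assumes V: "finite V" "V \<subseteq> rational_points" and k: "k > 0"
    and int: "\<And>v. v \<in> V \<Longrightarrow> real k *\<^sub>R v \<in> integer_points"
    and flat: "interior (convex hull V) = {}"
  shows "eventually_recurrent k (\<lambda>n. arith_width (dilate n (convex hull V)))"
proof -
  let ?P = "convex hull V"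
  obtain c \<beta> where c: "c \<in> integer_points" "c \<noteq> 0" "?P \<subseteq> {x. c \<bullet> x = \<beta>}"
    using flat_polytope_integer_normal[OF V(2) flat] by blast
  have le1: "arith_width (dilate n ?P) \<le> 1" for n
  proof -
    have "card (lattice_values c (dilate n ?P)) \<le> Suc 0"
    proof (subst card_le_Suc0_iff_eq)
      have "bounded ?P"
        using V(1) by (intro compact_imp_bounded compact_convex_hull finite_imp_compact)
      then show "finite (lattice_values c (dilate n ?P))"
        by (intro finite_lattice_values bounded_scaling)
      have "real_of_int z = real n * \<beta>" if "z \<in> lattice_values c (dilate n ?P)" for z
        using that c(3) by (auto simp: lattice_values_def)
      then show "\<forall>y\<in>lattice_values c (dilate n ?P). \<forall>z\<in>lattice_values c (dilate n ?P). y = z"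
        by (metis of_int_eq_iff)
    qed
    then show ?thesis
      using arith_width_le[OF c(1,2), of "dilate n ?P"] by (simp add: arith_width_dir_eq_card[OF c(1,2)])
  qed
  have pos: "arith_width (dilate n ?P) \<ge> 1 \<longleftrightarrow> dilate n ?P \<inter> integer_points \<noteq> {}" for n
  proof
    assume "arith_width (dilate n ?P) \<ge> 1"
    then have "card (lattice_values c (dilate n ?P)) \<ge> 1"
      using arith_width_le[OF c(1,2), of "dilate n ?P"] by (simp add: arith_width_dir_eq_card[OF c(1,2)])
    then have "lattice_values c (dilate n ?P) \<noteq> {}" by auto
    then show "dilate n ?P \<inter> integer_points \<noteq> {}" by (auto simp: lattice_values_def)
  next
    assume "dilate n ?P \<inter> integer_points \<noteq> {}"
    then obtain x where x: "x \<in> dilate n ?P" "x \<in> integer_points" by blast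
    have "1 \<le> arith_width_dir c' (dilate n ?P)" if c': "c' \<in> integer_points" "c' \<noteq> 0" for c'
    proof -
      obtain z where "c' \<bullet> x = of_int z"
        using inner_integer_points[OF c'(1) x(2)] by (auto elim: Ints_cases)
      then have "z \<in> lattice_values c' (dilate n ?P)" using x unfolding lattice_values_def by blast
      moreover have "finite (lattice_values c' (dilate n ?P))"
        using V(1) by (intro finite_lattice_values bounded_scaling compact_imp_bounded
            compact_convex_hull finite_imp_compact)
      ultimately show ?thesis
        by (auto simp: arith_width_dir_eq_card[OF c'] Suc_le_eq card_gt_0_iff)
    qed
    then show "arith_width (dilate n ?P) \<ge> 1"
      unfolding arith_width_def using c(1,2) by (intro cINF_greatest) auto
  qed
  have grow: "arith_width (dilate n ?P) + 0 \<le> arith_width (dilate (n + k) ?P)" for n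
  proof (cases "dilate n ?P \<inter> integer_points = {}")
    case True
    then show ?thesis using pos[of n] by simp
  next
    case False
    then obtain x where x: "x \<in> dilate n ?P" "x \<in> integer_points" by blast
    moreover from this have "V \<noteq> {}" by auto
    ultimately obtain v where "v \<in> V" by blast
    then have v: "real k *\<^sub>R v \<in> dilate k ?P" "real k *\<^sub>R v \<in> integer_points"
      using int by (auto intro: hull_inc)
    \<comment> \<open>The \<open>k\<close>-fold multiple of a vertex is an integer point, so adding
      it preserves the existence of integer points.\<close>
    have "x + real k *\<^sub>R v \<in> dilate (n + k) ?P \<inter> integer_points"
      using dilate_add[OF convex_convex_hull x(1) v(1)] integer_points_add[OF x(2) v(2)] by blast
    then show ?thesis using pos[of "n + k"] le1[of n] by force
  qed
  show ?thesis 
    \<comment> \<open>Increment 0: a sequence with values in {0, 1} that never drops after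
      \<open>k\<close> steps is eventually \<open>k\<close>-periodic.\<close>
    by (rule eventually_recurrentI[OF k, where N = 0 and D = 0 and E = 1]) (use grow le1 in simp_all)
qed

subsection \<open>Polytopes with nonempty interior\<close>

lemma unit_cube_in_dilate:
  fixes P :: "(real ^ 'd) set"
  assumes "interior P \<noteq> {}"
  shows "\<exists>N>0. \<forall>n\<ge>N. \<exists>x \<in> integer_points. \<forall>\<delta>. (\<forall>i. 0 \<le> \<delta> $ i \<and> \<delta> $ i \<le> 1) \<longrightarrow> x + \<delta> \<in> dilate n P"
proof -
  obtain y r where r: "r > 0" "cball y r \<subseteq> P"
    using assms by (auto simp: mem_interior_cball)
  \<comment> \<open>The ball of radius \<open>r\<close> grows to radius \<open>n * r\<close>.
    Rounding the centre down and adding \<open>\<delta>\<close> moves each coordinate by at most 1,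
    hence the point by at most the dimension. The \<open>+ 1\<close> keeps \<open>N\<close>
    positive.\<close>
  define N where "N = nat \<lceil>real CARD('d) / r\<rceil> + 1"
  have "\<exists>x \<in> integer_points. \<forall>\<delta>. (\<forall>i. 0 \<le> \<delta> $ i \<and> \<delta> $ i \<le> 1) \<longrightarrow> x + \<delta> \<in> dilate n P"
    if n: "n \<ge> N" for n
  proof (intro bexI allI impI)
    let ?x = "(\<chi> i. of_int \<lfloor>real n * y $ i\<rfloor>) :: real ^ 'd"
    show "?x \<in> integer_points" by (simp add: integer_points_def)
    fix \<delta> :: "real ^ 'd" assume \<delta>: "\<forall>i. 0 \<le> \<delta> $ i \<and> \<delta> $ i \<le> 1"
    have n0: "real n > 0" using n by (simp add: N_def)
    have "real CARD('d) / r \<le> real n" using n unfolding N_def by linarith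
    then have nr: "real CARD('d) \<le> real n * r" using r by (simp add: field_simps)
    have "norm (?x + \<delta> - real n *\<^sub>R y) \<le> (\<Sum>i\<in>UNIV. \<bar>(?x + \<delta> - real n *\<^sub>R y) $ i\<bar>)"
      by (rule norm_le_l1_cart)
    also have "\<dots> \<le> (\<Sum>i\<in>(UNIV :: 'd set). 1)"
    proof (intro sum_mono)
      fix i
      have "0 \<le> \<delta> $ i" "\<delta> $ i \<le> 1" using \<delta> by simp_all
      then show "\<bar>(?x + \<delta> - real n *\<^sub>R y) $ i\<bar> \<le> 1" by simp linarith
    qed
    also have "\<dots> \<le> real n * r" using nr by simp
    finally have le: "norm (?x + \<delta> - real n *\<^sub>R y) \<le> real n * r" .
    let ?z = "(1 / real n) *\<^sub>R (?x + \<delta>)"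
    have z: "?x + \<delta> = real n *\<^sub>R ?z" using n0 by simp
    have "real n * norm (?z - y) = norm (real n *\<^sub>R (?z - y))" using n0 by simp
    also have "real n *\<^sub>R (?z - y) = ?x + \<delta> - real n *\<^sub>R y"
      unfolding scaleR_diff_right z[symmetric] ..
    finally have "real n * norm (?z - y) \<le> real n * r" using le by simp
    then have "norm (?z - y) \<le> r" using n0 by simp
    then have "?z \<in> cball y r" by (simp add: dist_norm norm_minus_commute)
    then show "?x + \<delta> \<in> dilate n P" using r(2) by (intro image_eqI[of _ "\<lambda>x. real n *\<^sub>R x", OF z]) blast
  qed
  then show ?thesis by (intro exI[of _ N]) (auto simp: N_def)
qed

text \<open>The relation is written without quotients, so that zero coordinates need no special
  treatment.\<close>

definition commensurable :: "nat \<Rightarrow> real ^ 'd \<Rightarrow> bool"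
  where "commensurable M c \<longleftrightarrow> (\<forall>i j. \<exists>u v :: int. \<bar>u\<bar> \<le> int M \<and> \<bar>v\<bar> \<le> int M \<and>
    (u \<noteq> 0 \<or> v \<noteq> 0) \<and> of_int u * c $ i = of_int v * c $ j)"

text \<open>Dividing by a nonzero coordinate leaves the widths unchanged and puts all coordinates
  into a finite set of fractions. Finiteness is therefore stated for the width functions, not for
  the directions.\<close>

lemma finite_commensurable_widths:
  fixes K :: "nat \<Rightarrow> (real ^ 'd) set"
  shows "finite ((\<lambda>c n. arith_width_dir c (K n)) ` {c. c \<noteq> 0 \<and> commensurable M c})"
proof -
  \<comment> \<open>Pairs with \<open>v = 0\<close> merely contribute the default quotient
    0.\<close>
  define R :: "real set"
    where "R = (\<lambda>(u, v). of_int u / of_int v) ` ({- int M..int M} \<times> {- int M..int M})"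
  define Q :: "(real ^ 'd) set" where "Q = vec_lambda ` (UNIV \<rightarrow>\<^sub>E R)"
  have "finite Q" unfolding Q_def R_def by (intro finite_imageI finite_PiE) auto
  moreover have "(\<lambda>c n. arith_width_dir c (K n)) ` {c. c \<noteq> 0 \<and> commensurable M c} \<subseteq>
    (\<lambda>c n. arith_width_dir c (K n)) ` Q"
  proof (intro image_subsetI)
    fix c :: "real ^ 'd" assume "c \<in> {c. c \<noteq> 0 \<and> commensurable M c}"
    then have c: "c \<noteq> 0" "commensurable M c" by auto
    then obtain i where i: "c $ i \<noteq> 0" by (auto simp: vec_eq_iff)
    define q where "q = (1 / c $ i) *\<^sub>R c"
    have "q $ j \<in> R" for j
    proof -
      obtain u v :: int where uv: "\<bar>u\<bar> \<le> int M" "\<bar>v\<bar> \<le> int M" "u \<noteq> 0 \<or> v \<noteq> 0"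
        "of_int u * c $ i = of_int v * c $ j"
        using c(2) unfolding commensurable_def by blast
      \<comment> \<open>Were \<open>v\<close> zero, the relation would force \<open>u\<close> to be
        zero as well.\<close>
      then have "v \<noteq> 0" using i by auto
      then have "q $ j = of_int u / of_int v" using uv(4) i by (simp add: q_def field_simps)
      then show ?thesis using uv(1,2) by (auto simp: R_def intro!: image_eqI[of _ _ "(u, v)"])
    qed
    then have "($) q \<in> UNIV \<rightarrow>\<^sub>E R" by auto
    then have "q \<in> Q" unfolding Q_def by (metis image_eqI vec_lambda_eta)
    moreover have "arith_width_dir c (K n) = arith_width_dir q (K n)" for n
      unfolding q_def using i by (subst arith_width_dir_scaleR) simp_all
    ultimately show "(\<lambda>n. arith_width_dir c (K n)) \<in> (\<lambda>c n. arith_width_dir c (K n)) ` Q"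
      by (intro image_eqI[of _ _ q]) auto
  qed
  ultimately show ?thesis by (meson finite_imageI finite_subset)
qed

text \<open>Moving from \<open>M\<close> times \<open>x\<close> by \<open>u\<close> and
  \<open>v\<close> steps along axes \<open>i\<close> and \<open>j\<close> changes the value by
  \<open>u * p + v * q\<close>. A coincidence between two such values would be a relation with
  coefficients bounded by \<open>M\<close>.\<close>

lemma card_lattice_values_incommensurable:
  fixes c :: "real ^ 'd"
  assumes "bounded P" and c: "c \<in> integer_points" "\<not> commensurable M c"
    and M: "M > 0" and x: "x \<in> integer_points"
    and cube: "\<And>\<delta>. (\<And>i. 0 \<le> \<delta> $ i \<and> \<delta> $ i \<le> 1) \<Longrightarrow> x + \<delta> \<in> dilate m P"
  shows "(M + 1)\<^sup>2 \<le> card (lattice_values c (dilate (M * m) P))"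
proof -
  obtain i j where ij: "\<And>u v :: int. \<bar>u\<bar> \<le> int M \<Longrightarrow> \<bar>v\<bar> \<le> int M \<Longrightarrow>
      of_int u * c $ i = of_int v * c $ j \<Longrightarrow> u = 0 \<and> v = 0"
    using c(2) unfolding commensurable_def by blast
  have "i \<noteq> j" using ij[of 1 1] M by auto
  have "c $ i \<in> \<int>" "c $ j \<in> \<int>" using c(1) by (simp_all add: integer_points_def)
  then obtain p q where p: "c $ i = of_int p" and q: "c $ j = of_int q"
    by (auto elim!: Ints_cases)
  obtain s where s: "c \<bullet> x = of_int s"
    using inner_integer_points[OF c(1) x] by (auto elim: Ints_cases)
  define g where "g = (\<lambda>(u, v). int M * s + u * p + v * q)"
  let ?I = "{0..int M} \<times> {0..int M}"
  have "inj_on g ?I"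
  proof (rule inj_onI)
    fix a b assume ab: "a \<in> ?I" "b \<in> ?I" "g a = g b"
    obtain u v u' v' where uv: "a = (u, v)" "b = (u', v')" by fastforce
    have "(u - u') * p = (v' - v) * q" using ab(3) by (simp add: uv g_def algebra_simps)
    then have "of_int (u - u') * c $ i = of_int (v' - v) * c $ j"
      unfolding p q by (metis of_int_mult)
    then have "u - u' = 0 \<and> v' - v = 0" using ab(1,2) by (intro ij) (auto simp: uv)
    then show "a = b" by (simp add: uv)
  qed
  then have "card (g ` ?I) = (M + 1)\<^sup>2"
    by (simp add: card_image power2_eq_square nat_add_distrib)
  moreover have "g ` ?I \<subseteq> lattice_values c (dilate (M * m) P)"
  proof (rule image_subsetI)
    fix a assume "a \<in> ?I"
    then obtain u v where a: "a = (u, v)" "0 \<le> u" "u \<le> int M" "0 \<le> v" "v \<le> int M" by auto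
    have le: "real_of_int u \<le> real M" "real_of_int v \<le> real M" using a by linarith+
    \<comment> \<open>Chosen so that \<open>M\<close> times \<open>x + \<delta>\<close> is the
      integer point reached by these steps.\<close>
    define \<delta> :: "real ^ 'd" where "\<delta> = axis i (of_int u / real M) + axis j (of_int v / real M)"
    have "0 \<le> \<delta> $ l \<and> \<delta> $ l \<le> 1" for l
      using a M le \<open>i \<noteq> j\<close> by (auto simp: \<delta>_def axis_def)
    then have "x + \<delta> \<in> dilate m P" by (rule cube)
    then obtain y where y: "y \<in> P" "x + \<delta> = real m *\<^sub>R y" by blast
    have eq: "real M *\<^sub>R (x + \<delta>) = real M *\<^sub>R x + (axis i (of_int u) + axis j (of_int v))"
      using M by (auto simp: vec_eq_iff \<delta>_def axis_def algebra_simps)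
    have "real M *\<^sub>R (x + \<delta>) \<in> dilate (M * m) P" using y by auto
    moreover have "real M *\<^sub>R (x + \<delta>) \<in> integer_points"
      unfolding eq using x by (auto simp: integer_points_def axis_def)
    moreover have "c \<bullet> (real M *\<^sub>R (x + \<delta>)) = of_int (g a)"
      unfolding eq by (simp add: a(1) g_def inner_add_right inner_axis s p q mult.commute)
    ultimately show "g a \<in> lattice_values c (dilate (M * m) P)"
      unfolding lattice_values_def by blast
  qed
  then have "card (g ` ?I) \<le> card (lattice_values c (dilate (M * m) P))"
    by (intro card_mono finite_lattice_values bounded_scaling assms(1))
  ultimately show ?thesis by simp
qed

text \<open>If \<open>c\<close> has two incommensurable coordinates, a dilate by \<open>M * m\<close> already yields
  \<open>(M + 1)\<^sup>2\<close> values, and sumset growth turns this into growth at rate at least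
  \<open>(M + 2) / m > 2 * B\<close>, more than a coordinate direction can have.\<close>
lemma arith_width_dir_incommensurable:
  fixes P :: "(real ^ 'd) set"
  assumes P: "convex P" "bounded P" and B: "B > 0" and m: "m > 0"
    and cubes: "\<And>n. n \<ge> m \<Longrightarrow> \<exists>x \<in> integer_points.
      \<forall>\<delta>. (\<forall>i. 0 \<le> \<delta> $ i \<and> \<delta> $ i \<le> 1) \<longrightarrow> x + \<delta> \<in> dilate n P"
    and M: "M = 2 * B * m"
    and c: "c \<in> integer_points" "c \<noteq> 0" "\<not> commensurable M c"
    and n: "n \<ge> m + B * (m + M * m) * (M * m)"
  shows "2 * n * B + 1 \<le> arith_width_dir c (dilate n P)"
proof -
  interpret superadditive_sets "\<lambda>n. lattice_values c (dilate n P)"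
    by (rule superadditive_lattice_values[OF P])
  define t where "t = (n - m) div (M * m)"
  \<comment> \<open>The remainder is kept at least \<open>m\<close>, so that the dilate by
    \<open>r\<close> contains an integer point.\<close>
  define r where "r = m + (n - m) mod (M * m)"
  have Mm: "M * m > 0" using B m M by simp
  have n_eq: "n = t * (M * m) + r"
    using n div_mult_mod_eq[of "n - m" "M * m"] unfolding t_def r_def by linarith
  have r: "r \<ge> m" "r \<le> m + M * m" using Mm by (simp_all add: r_def less_imp_le)
  have "(B * (m + M * m) * (M * m)) div (M * m) \<le> t"
    unfolding t_def using n by (intro div_le_mono) linarith
  then have t: "B * (m + M * m) \<le> t" using Mm by simp
  have r_ne: "lattice_values c (dilate r P) \<noteq> {}"
  proof -
    obtain x where x: "x \<in> integer_points"
      "\<forall>\<delta>. (\<forall>i. 0 \<le> \<delta> $ i \<and> \<delta> $ i \<le> 1) \<longrightarrow> x + \<delta> \<in> dilate r P"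
      using cubes[OF r(1)] by blast
    then have "x + 0 \<in> dilate r P" by (intro x(2)[rule_format]) simp
    moreover obtain z where "c \<bullet> x = of_int z"
      using inner_integer_points[OF c(1) x(1)] by (auto elim: Ints_cases)
    ultimately show ?thesis using x(1) unfolding lattice_values_def by auto
  qed
  obtain x where x: "x \<in> integer_points"
    "\<forall>\<delta>. (\<forall>i. 0 \<le> \<delta> $ i \<and> \<delta> $ i \<le> 1) \<longrightarrow> x + \<delta> \<in> dilate m P"
    using cubes[of m] by blast
  have "(M + 1)\<^sup>2 \<le> card (lattice_values c (dilate (M * m) P))"
    using B m M x by (intro card_lattice_values_incommensurable[OF P(2) c(1,3)]) auto
  then have big: "M * (M + 2) \<le> card (lattice_values c (dilate (M * m) P)) - 1"
    by (simp add: power2_eq_square)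
  then have ne: "lattice_values c (dilate (M * m) P) \<noteq> {}" using Mm by auto
  have "t * (M * (M + 2)) + 1 \<le>
      t * (card (lattice_values c (dilate (M * m) P)) - 1) + card (lattice_values c (dilate r P))"
    using big r_ne by (intro add_mono mult_le_mono2) (simp_all add: Suc_le_eq card_gt_0_iff)
  also have "\<dots> \<le> card (lattice_values c (dilate n P))"
    unfolding n_eq using card_mult_add[OF ne r_ne, of t] by blast
  also have "\<dots> = arith_width_dir c (dilate n P)" by (rule arith_width_dir_eq_card[OF c(1,2), symmetric])
  finally have "t * (M * (M + 2)) + 1 \<le> arith_width_dir c (dilate n P)" .
  \<comment> \<open>Split \<open>M * (M + 2)\<close> into two parts: \<open>M * M\<close> pays for
    the \<open>t\<close> blocks of length \<open>M * m\<close>, and \<open>2 * M\<close> pays for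
    the remainder \<open>r\<close>, as \<open>t\<close> is at least
    \<open>B * (m + M * m)\<close>.\<close>
  moreover have "2 * n * B \<le> t * (M * (M + 2))"
  proof -
    have "t * 1 \<le> t * M" using Mm by (intro mult_le_mono2) simp
    moreover have "B * r \<le> B * (m + M * m)" using r(2) by (rule mult_le_mono2)
    ultimately have "2 * (B * r) \<le> 2 * (t * M)" using t by linarith
    moreover have "2 * n * B = t * M * (2 * B * m) + 2 * (B * r)"
      unfolding n_eq by (simp add: algebra_simps)
    ultimately show ?thesis by (simp add: M algebra_simps)
  qed
  ultimately show ?thesis by linarith
qed

text \<open>The benchmark that directions with incommensurable coordinates are shown to
  reach.\<close>

lemma arith_width_dir_axis_le:
  assumes "\<And>x. x \<in> P \<Longrightarrow> norm x \<le> real B"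
  shows "arith_width_dir (axis i 1) (dilate n P) \<le> 2 * n * B + 1"
proof -
  have "(axis i 1 :: real ^ 'a) \<in> integer_points" "(axis i 1 :: real ^ 'a) \<noteq> 0"
    by (auto simp: integer_points_def axis_def vec_eq_iff)
  note eq = arith_width_dir_eq_card[OF this]
  have "lattice_values (axis i 1) (dilate n P) \<subseteq> {- int (n * B)..int (n * B)}"
  proof
    fix z assume "z \<in> lattice_values (axis i 1) (dilate n P)"
    then obtain x where x: "x \<in> P" "axis i 1 \<bullet> (real n *\<^sub>R x) = of_int z"
      unfolding lattice_values_def by blast
    have "\<bar>x $ i\<bar> \<le> real B" using component_le_norm_cart[of x i] assms[OF x(1)] by linarith
    then have "real n * \<bar>x $ i\<bar> \<le> real n * real B" by (rule mult_left_mono) simp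
    moreover have "real n * x $ i = of_int z" using x(2) by (simp add: inner_axis')
    then have "\<bar>real n * x $ i\<bar> = of_int \<bar>z\<bar>" by simp
    then have "real n * \<bar>x $ i\<bar> = of_int \<bar>z\<bar>" by (simp add: abs_mult)
    ultimately have "of_int \<bar>z\<bar> \<le> real (n * B)" by simp
    then have "\<bar>z\<bar> \<le> int (n * B)" by linarith
    then show "z \<in> {- int (n * B)..int (n * B)}" by auto
  qed
  then have "card (lattice_values (axis i 1) (dilate n P)) \<le> card {- int (n * B)..int (n * B)}"
    by (intro card_mono) simp_all
  then show ?thesis by (simp add: eq nat_add_distrib nat_mult_distrib algebra_simps)
qed

lemma eventually_recurrent_full:
  fixes V :: "(real ^ 'd) set"
  assumes V: "finite V" and k: "k > 0"
    and int: "\<And>v. v \<in> V \<Longrightarrow> real k *\<^sub>R v \<in> integer_points"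
    and full: "interior (convex hull V) \<noteq> {}"
  shows "eventually_recurrent k (\<lambda>n. arith_width (dilate n (convex hull V)))"
proof -
  let ?P = "convex hull V"
  have bdd: "bounded ?P"
    using V by (intro compact_imp_bounded compact_convex_hull finite_imp_compact)
  then obtain b where b: "\<And>x. x \<in> ?P \<Longrightarrow> norm x \<le> b" by (auto simp: bounded_iff)
  define B where "B = nat \<lceil>b\<rceil> + 1"
  have "B > 0" by (simp add: B_def)
  have "b \<le> real B" unfolding B_def by linarith
  then have B: "\<And>x. x \<in> ?P \<Longrightarrow> norm x \<le> real B" using b by fastforce
  obtain m where m: "m > 0" and cubes: "\<And>n. n \<ge> m \<Longrightarrow> \<exists>x \<in> integer_points.
      \<forall>\<delta>. (\<forall>i. 0 \<le> \<delta> $ i \<and> \<delta> $ i \<le> 1) \<longrightarrow> x + \<delta> \<in> dilate n ?P"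
    using unit_cube_in_dilate[OF full] by blast
  define M where "M = 2 * B * m"
  define F :: "(real ^ 'd) set" where "F = {c \<in> integer_points - {0}. commensurable M c}"
  \<comment> \<open>A set of functions: \<open>F\<close> is infinite, as it contains the nonzero
    integer multiples of an axis vector.\<close>
  define G where "G = (\<lambda>c n. arith_width_dir c (dilate n ?P)) ` F"
  have "finite G" unfolding G_def F_def
    by (rule finite_subset[OF _ finite_commensurable_widths[of "\<lambda>n. dilate n ?P" M]]) auto
  fix i0 :: 'd
  let ?e = "axis i0 1 :: real ^ 'd"
  have e: "?e \<in> F"
  proof -
    have "M \<ge> 1" using \<open>B > 0\<close> m by (simp add: M_def)
    then have "\<exists>u v :: int. \<bar>u\<bar> \<le> int M \<and> \<bar>v\<bar> \<le> int M \<and> (u \<noteq> 0 \<or> v \<noteq> 0) \<and>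
        of_int u * ?e $ i = of_int v * ?e $ j" for i j
      by (intro exI[of _ "if i = i0 \<and> j \<noteq> i0 then 0 else 1"] exI[of _ "if i = i0 then 1 else 0"])
        (auto simp: axis_def)
    then have "commensurable M ?e" unfolding commensurable_def by blast
    then show ?thesis by (auto simp: F_def integer_points_def axis_def vec_eq_iff)
  qed
  have "eventually_recurrent k f" if f: "f \<in> G" for f
  proof -
    obtain c where c: "c \<in> F" "f = (\<lambda>n. arith_width_dir c (dilate n ?P))"
      using f unfolding G_def by blast
    have "dilate n ?P \<inter> integer_points \<noteq> {}" if "n \<ge> m" for n
    proof -
      obtain x where x: "x \<in> integer_points"
        "\<forall>\<delta>. (\<forall>i. 0 \<le> \<delta> $ i \<and> \<delta> $ i \<le> 1) \<longrightarrow> x + \<delta> \<in> dilate n ?P"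
        using cubes[OF \<open>n \<ge> m\<close>] by blast
      then have "x + 0 \<in> dilate n ?P" by (intro x(2)[rule_format]) simp
      then show ?thesis using x(1) by auto
    qed
    moreover have "V \<noteq> {}" using full by auto
    ultimately show ?thesis
      using c(1) unfolding c(2) F_def by (intro eventually_recurrent_arith_width_dir V k int) auto
  qed
  then have rec: "eventually_recurrent k (\<lambda>n. Min ((\<lambda>f. f n) ` G))"
    using \<open>finite G\<close> e k by (intro eventually_recurrent_Min) (auto simp: G_def)
  have "arith_width (dilate n ?P) = Min ((\<lambda>f. f n) ` G)"
    if n: "n \<ge> m + B * (m + M * m) * (M * m)" for n
  proof (rule antisym)
    have "Min ((\<lambda>f. f n) ` G) \<in> (\<lambda>f. f n) ` G"
      using \<open>finite G\<close> e by (intro Min_in) (auto simp: G_def)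
    then obtain c where "c \<in> F" "Min ((\<lambda>f. f n) ` G) = arith_width_dir c (dilate n ?P)"
      by (auto simp: G_def)
    then show "arith_width (dilate n ?P) \<le> Min ((\<lambda>f. f n) ` G)"
      by (auto simp: F_def intro: arith_width_le)
  next
    have Min_le: "Min ((\<lambda>f. f n) ` G) \<le> arith_width_dir c (dilate n ?P)" if "c \<in> F" for c
      using \<open>finite G\<close> that by (intro Min_le) (auto simp: G_def)
    have "Min ((\<lambda>f. f n) ` G) \<le> arith_width_dir c (dilate n ?P)"
      if c: "c \<in> integer_points - {0}" for c
    proof (cases "c \<in> F")
      case True
      then show ?thesis by (rule Min_le)
    next
      case False
      \<comment> \<open>The axis direction belongs to \<open>F\<close>, so every direction outside
        \<open>F\<close> is at least as wide as some member of \<open>F\<close>.\<close>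
      have "Min ((\<lambda>f. f n) ` G) \<le> arith_width_dir ?e (dilate n ?P)" by (rule Min_le[OF e])
      also have "\<dots> \<le> 2 * n * B + 1" by (rule arith_width_dir_axis_le[OF B])
      also have "\<dots> \<le> arith_width_dir c (dilate n ?P)"
        using c False by (intro arith_width_dir_incommensurable[OF convex_convex_hull bdd \<open>B > 0\<close> m
              cubes M_def _ _ _ n]) (auto simp: F_def)
      finally show ?thesis .
    qed
    moreover have "integer_points - {0 :: real ^ 'd} \<noteq> {}" using e by (auto simp: F_def)
    ultimately show "Min ((\<lambda>f. f n) ` G) \<le> arith_width (dilate n ?P)"
      unfolding arith_width_def by (intro cINF_greatest)
  qed
  then show ?thesis by (rule eventually_recurrent_cong[OF rec])
qed

theorem theorem4p8:
  fixes P :: "(real ^ 'd) set"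
  assumes "rational_polytope P"
  shows "eventually_quasilinear (\<lambda>n. int (arith_width ((\<lambda>x. real n *\<^sub>R x) ` P)))"
proof -
  obtain V where V: "finite V" "V \<subseteq> rational_points" "P = convex hull V"
    using assms unfolding rational_polytope_def by blast
  \<comment> \<open>This common denominator is the period in both cases. An empty \<open>V\<close>
    falls under the case of empty interior.\<close>
  obtain k :: nat where k: "k > 0" "\<And>v. v \<in> V \<Longrightarrow> real k *\<^sub>R v \<in> integer_points"
    using common_denominator_vec[OF V(1,2)] by blast
  have "eventually_recurrent k (\<lambda>n. arith_width (dilate n P))"
    using eventually_recurrent_flat[OF V(1,2) k] eventually_recurrent_full[OF V(1) k]
    unfolding V(3) by blast
  then show ?thesis by (rule eventually_recurrent_imp_quasilinear[OF k(1)])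
qed

end
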